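(* Let $\mathcal{B}$ be a front on $\mathbb{N}$. There is a tall ideal $\mathcal{I}$ on $\mathbb{N}$ which is co-analytic (a $\mathbf{\Pi}^1_1$ subset of $2^{\mathbb{N}}$) such that $hom(\mathcal{F})\not\subseteq\mathcal{I}$ for every $\mathcal{F}\subseteq\mathcal{B}$.
   Context: Subsets of $\mathbb{N}$ are identified with elements of $2^{\mathbb{N}}$. An ideal on $\mathbb{N}$ is a hereditary family closed under finite unions; tall means every infinite $x\subseteq\mathbb{N}$ has an infinite subset in the family. For finite $s$ and $t\subseteq\mathbb{N}$, $s\sqsubseteq t$ means $s=t\cap\{0,\dots,n\}$ for some $n$. A front on an infinite set $x$ is a family $\mathcal{B}\subseteq[x]^{<\omega}$ whose elements are pairwise $\sqsubseteq$-incomparable and such that every infinite $y\subseteq x$ has an initial segment in $\mathcal{B}$. For $\mathcal{F}\subseteq\mathcal{B}$, $hom(\mathcal{F})$ is the set of infinite $y\subseteq\mathbb{N}$ such that either $[y]^{<\omega}\cap\mathcal{B}\subseteq\mathcal{F}$ or $[y]^{<\omega}\cap\mathcal{F}=\emptyset$. *)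

theory Defs
  imports Main
begin

text \<open>Subsets of the naturals are identified with points of the Cantor space 2^N.\<close>

definition init_seg :: "nat set \<Rightarrow> nat set \<Rightarrow> bool" where
  "init_seg s t \<longleftrightarrow> (\<exists>n. s = t \<inter> {0..n})"

definition front_on :: "nat set set \<Rightarrow> nat set \<Rightarrow> bool" where
  "front_on B x \<longleftrightarrow> infinite x
     \<and> (\<forall>s\<in>B. finite s \<and> s \<subseteq> x)
     \<and> (\<forall>s\<in>B. \<forall>t\<in>B. s \<noteq> t \<longrightarrow> \<not> init_seg s t \<and> \<not> init_seg t s)
     \<and> (\<forall>y. y \<subseteq> x \<and> infinite y \<longrightarrow> (\<exists>s\<in>B. init_seg s y))"

definition hom :: "nat set set \<Rightarrow> nat set set \<Rightarrow> nat set set" where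
  "hom B F = {y. infinite y \<and>
      ({s. finite s \<and> s \<subseteq> y} \<inter> B \<subseteq> F \<or> {s. finite s \<and> s \<subseteq> y} \<inter> F = {})}"

definition ideal_on_nat :: "nat set set \<Rightarrow> bool" where
  "ideal_on_nat I \<longleftrightarrow> {} \<in> I
     \<and> (\<forall>a\<in>I. \<forall>b. b \<subseteq> a \<longrightarrow> b \<in> I)
     \<and> (\<forall>a\<in>I. \<forall>b\<in>I. a \<union> b \<in> I)"

definition tall :: "nat set set \<Rightarrow> bool" where
  "tall I \<longleftrightarrow> (\<forall>x. infinite x \<longrightarrow> (\<exists>y. y \<subseteq> x \<and> infinite y \<and> y \<in> I))"

text \<open>Analytic subsets of 2^N: projections p[T] of (bodies of) trees T on 2 x omega,
  i.e. projections of closed subsets of 2^N x N^N.\<close>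
definition analytic :: "nat set set \<Rightarrow> bool" where
  "analytic A \<longleftrightarrow> (\<exists>T :: (bool list \<times> nat list) set.
     \<forall>x. x \<in> A \<longleftrightarrow> (\<exists>f :: nat \<Rightarrow> nat. \<forall>n.
        (map (\<lambda>i. i \<in> x) [0..<n], map f [0..<n]) \<in> T))"

definition coanalytic :: "nat set set \<Rightarrow> bool" where
  "coanalytic A \<longleftrightarrow> analytic (- A)"

end

theory Submission
  imports Defs "HOL-Analysis.Function_Topology" "HOL-Library.Countable" "HOL-Library.Nat_Bijection"
begin

text \<open>Give each colouring \<open>F\<close> its own infinite set, the codes of the finite restrictions of \<open>F\<close>; these
  sets are almost disjoint. The usual fusion proof of Nash-Williams' theorem, by recursion on the rank
  of the front, selects inside it a homogeneous set \<open>Y F\<close>, and since every step is arithmetical in the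
  previous ones, the graph of the selection is analytic. Now let \<open>I\<close> consist of the sets whose trace
  on each \<open>Y F\<close> belongs to a fixed tall proper Borel ideal on \<open>Y F\<close>. It is co-analytic and contains
  no \<open>Y F\<close>. It is tall because an infinite set either is almost disjoint from all \<open>Y F\<close>, or can be
  thinned out inside a single one.\<close>

subsection \<open>Clopen and analytic predicates\<close>

text \<open>The preimage of an open set splits over the values \<open>n\<close> of \<open>h\<close>
  into open pieces, on each of which the function is \<open>G n\<close>. As \<open>bool\<close> is
  discrete, a continuous predicate is a clopen one, and the clopen combinations below rest on this
  fact.\<close>

lemma continuous_on_discrete_select:
  fixes h :: "'a::topological_space \<Rightarrow> 'n::discrete_topology"
  assumes h: "continuous_on UNIV h" and G: "\<And>n. continuous_on UNIV (G n)"
  shows "continuous_on UNIV (\<lambda>x. G (h x) x)"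
proof -
  have "open ((\<lambda>x. G (h x) x) -` U)" if U: "open U" for U
  proof -
    have "(\<lambda>x. G (h x) x) -` U = (\<Union>n. h -` {n} \<inter> G n -` U)" by auto
    moreover have "open (h -` {n} \<inter> G n -` U)" for n
      using open_vimage[OF open_discrete h, of "{n}"] open_vimage[OF U G] by blast
    ultimately show ?thesis by auto
  qed
  then show ?thesis by (simp add: continuous_on_open_vimage)
qed

lemma continuous_on_discrete_unary:
  fixes f :: "'a::topological_space \<Rightarrow> 'n::discrete_topology"
  assumes "continuous_on UNIV f"
  shows "continuous_on UNIV (\<lambda>x. g (f x))"
  by (rule continuous_on_discrete_select[OF assms]) simp

lemma continuous_on_discrete_binary:
  fixes f :: "'a::topological_space \<Rightarrow> 'n::discrete_topology" and g :: "'a \<Rightarrow> 'm::discrete_topology"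
  assumes "continuous_on UNIV f" "continuous_on UNIV g"
  shows "continuous_on UNIV (\<lambda>x. k (f x) (g x))"
  by (rule continuous_on_discrete_select[OF assms(1)]) (rule continuous_on_discrete_unary[OF assms(2)])

lemma continuous_on_conj:
  assumes "continuous_on UNIV P" "continuous_on UNIV Q"
  shows "continuous_on UNIV (\<lambda>x::'a::topological_space. P x \<and> Q x)"
  by (rule continuous_on_discrete_binary[OF assms])

lemma continuous_on_iff_pred:
  assumes "continuous_on UNIV P" "continuous_on UNIV Q"
  shows "continuous_on UNIV (\<lambda>x::'a::topological_space. P x \<longleftrightarrow> Q x)"
  by (rule continuous_on_discrete_binary[OF assms])

lemma continuous_on_neg:
  assumes "continuous_on UNIV P"
  shows "continuous_on UNIV (\<lambda>x::'a::topological_space. \<not> P x)"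
  by (rule continuous_on_discrete_unary[OF assms])

lemma continuous_on_bounded_all:
  fixes P :: "nat \<Rightarrow> 'a::topological_space \<Rightarrow> bool"
  assumes "\<And>k. continuous_on UNIV (P k)"
  shows "continuous_on UNIV (\<lambda>x. \<forall>k<n. P k x)"
proof (induction n)
  case (Suc n)
  have "(\<forall>k<Suc n. P k x) \<longleftrightarrow> (\<forall>k<n. P k x) \<and> P n x" for x
    by (auto simp: less_Suc_eq)
  then show ?case using continuous_on_conj[OF Suc assms[of n]] by simp
qed simp

text \<open>The count reads only finitely many coordinates of \<open>f x\<close>, so it is locally
  constant.\<close>

lemma continuous_on_card_below:
  fixes f :: "'a::topological_space \<Rightarrow> nat \<Rightarrow> bool"
  assumes "continuous_on UNIV f"
  shows "continuous_on UNIV (\<lambda>x. card {k. k < n \<and> f x k})"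
proof (induction n)
  case (Suc n)
  have *: "card {k. k < Suc n \<and> f x k} = (if f x n then Suc else id) (card {k. k < n \<and> f x k})" for x
  proof -
    have "{k. k < Suc n \<and> f x k} = (if f x n then {n} else {}) \<union> {k. k < n \<and> f x k}"
      by (auto simp: less_Suc_eq)
    then show ?thesis by simp
  qed
  show ?case unfolding *
    by (rule continuous_on_discrete_binary[OF continuous_on_product_then_coordinatewise[OF assms] Suc])
qed simp

lemma closed_Collect_pred:
  assumes "continuous_on UNIV P"
  shows "closed {x::'a::topological_space. P x}"
proof -
  have "closed (P -` {True})"
    by (rule closed_vimage[OF _ assms]) (simp add: closed_def open_discrete)
  then show ?thesis by (simp add: vimage_def)
qed

section \<open>Closure properties of analytic predicates\<close>

text \<open>Projections of closed sets along Baire space, over an arbitrary space, so that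
  colourings, reservoirs and witnesses can be carried as factors of a product. Trees return only in
  \<open>analytic_if_sigma11\<close>.\<close>

definition sigma11 :: "('a::topological_space \<Rightarrow> bool) \<Rightarrow> bool" where
  "sigma11 P \<longleftrightarrow> (\<exists>C. closed C \<and> (\<forall>x. P x \<longleftrightarrow> (\<exists>f::nat \<Rightarrow> nat. (x, f) \<in> C)))"

lemma sigma11I:
  assumes "closed C" "\<And>x. P x \<longleftrightarrow> (\<exists>f::nat \<Rightarrow> nat. (x, f) \<in> C)"
  shows "sigma11 P"
  using assms unfolding sigma11_def by blast

lemma sigma11_closed: "closed {x. P x} \<Longrightarrow> sigma11 P"
  by (rule sigma11I[of "{x. P x} \<times> UNIV"]) (auto intro: closed_Times)

lemma sigma11_clopen: "continuous_on UNIV P \<Longrightarrow> sigma11 P"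
  by (intro sigma11_closed closed_Collect_pred)

lemma sigma11_subst:
  fixes h :: "'a::topological_space \<Rightarrow> 'b::topological_space"
  assumes "sigma11 P" "continuous_on UNIV h"
  shows "sigma11 (\<lambda>x. P (h x))"
proof -
  obtain C where C: "closed C" "\<And>x. P x \<longleftrightarrow> (\<exists>f::nat \<Rightarrow> nat. (x, f) \<in> C)"
    using assms(1) unfolding sigma11_def by blast
  have "continuous_on UNIV (\<lambda>z::'a \<times> (nat \<Rightarrow> nat). (h (fst z), snd z))"
    by (intro continuous_intros continuous_on_compose2[OF assms(2)]) auto
  from closed_vimage[OF C(1) this] show ?thesis
    by (rule sigma11I) (simp add: C(2))
qed

text \<open>One function stores a witness for every \<open>k\<close>, namely its \<open>k\<close>-th
  row under \<open>prod_encode\<close>, and an intersection of closed preimages is closed.\<close>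

lemma sigma11_all:
  assumes "\<And>k::nat. sigma11 (P k)"
  shows "sigma11 (\<lambda>x::'a::topological_space. \<forall>k. P k x)"
proof -
  have "\<forall>k. \<exists>C. closed C \<and> (\<forall>x. P k x \<longleftrightarrow> (\<exists>f::nat \<Rightarrow> nat. (x, f) \<in> C))"
    using assms unfolding sigma11_def by blast
  then obtain C where C: "\<And>k. closed (C k)" "\<And>k x. P k x \<longleftrightarrow> (\<exists>f::nat \<Rightarrow> nat. (x, f) \<in> C k)"
    by metis
  define h where "h k = (\<lambda>z::'a \<times> (nat \<Rightarrow> nat). (fst z, \<lambda>n. snd z (prod_encode (k, n))))" for k
  have h: "continuous_on UNIV (h k)" for k
    unfolding h_def
    by (intro continuous_intros continuous_on_product_then_coordinatewise[of UNIV snd])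
  show ?thesis
  proof (rule sigma11I[of "\<Inter>k. h k -` C k"])
    show "closed (\<Inter>k. h k -` C k)"
      using closed_vimage[OF C(1) h] by blast
    fix x
    show "(\<forall>k. P k x) \<longleftrightarrow> (\<exists>f. (x, f) \<in> (\<Inter>k. h k -` C k))"
    proof
      assume "\<forall>k. P k x"
      then have "\<forall>k. \<exists>f. (x, f) \<in> C k" using C(2) by simp
      then obtain g where g: "\<And>k. (x, g k) \<in> C k" by metis
      have "(x, \<lambda>n. g (fst (prod_decode n)) (snd (prod_decode n))) \<in> (\<Inter>k. h k -` C k)"
        using g by (simp add: h_def)
      then show "\<exists>f. (x, f) \<in> (\<Inter>k. h k -` C k)" by blast
    qed (use C(2) in \<open>auto simp: h_def\<close>)
  qed
qed

text \<open>The value of the witness at 0 names \<open>k\<close>; its shift is a witness for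
  \<open>P k\<close>.\<close>

lemma sigma11_ex:
  assumes "\<And>k::nat. sigma11 (P k)"
  shows "sigma11 (\<lambda>x::'a::topological_space. \<exists>k. P k x)"
proof -
  have "\<forall>k. \<exists>C. closed C \<and> (\<forall>x. P k x \<longleftrightarrow> (\<exists>f::nat \<Rightarrow> nat. (x, f) \<in> C))"
    using assms unfolding sigma11_def by blast
  then obtain C where C: "\<And>k. closed (C k)" "\<And>k x. P k x \<longleftrightarrow> (\<exists>f::nat \<Rightarrow> nat. (x, f) \<in> C k)"
    by metis
  define h where "h = (\<lambda>z::'a \<times> (nat \<Rightarrow> nat). (fst z, \<lambda>n. snd z (Suc n)))"
  have h: "continuous_on UNIV h"
    unfolding h_def
    by (intro continuous_intros continuous_on_product_then_coordinatewise[of UNIV snd])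
  have h0: "continuous_on UNIV (\<lambda>z::'a \<times> (nat \<Rightarrow> nat). snd z 0)"
    by (intro continuous_intros continuous_on_product_then_coordinatewise[of UNIV snd])
  show ?thesis
  proof (rule sigma11I[of "{z. h z \<in> C (snd z 0)}"])
    \<comment> \<open>An infinite union of closed sets need not be closed, but here the value at 0
      puts the pieces into disjoint clopen slabs, so the complement is a union of open sets.\<close>
    have "- {z. h z \<in> C (snd z 0)} = (\<Union>k. (\<lambda>z. snd z 0) -` {k} \<inter> - (h -` C k))"
      by auto
    moreover have "open ((\<lambda>z. snd z 0) -` {k} \<inter> - (h -` C k))" for k
      using open_vimage[OF open_discrete h0] closed_vimage[OF C(1) h] by blast
    ultimately show "closed {z. h z \<in> C (snd z 0)}"
      by (metis (no_types, lifting) closed_def open_UN)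
    fix x
    show "(\<exists>k. P k x) \<longleftrightarrow> (\<exists>f. (x, f) \<in> {z. h z \<in> C (snd z 0)})"
    proof
      assume "\<exists>k. P k x"
      then obtain k g where g: "(x, g) \<in> C k" using C(2) by metis
      have "(x, case_nat k g) \<in> {z. h z \<in> C (snd z 0)}"
        using g by (simp add: h_def)
      then show "\<exists>f. (x, f) \<in> {z. h z \<in> C (snd z 0)}" by blast
    qed (use C(2) in \<open>auto simp: h_def\<close>)
  qed
qed

text \<open>The countable case for the sequence \<open>P, Q, Q, ...\<close>; disjunction is treated
  in the same way.\<close>

lemma sigma11_conj:
  assumes "sigma11 P" "sigma11 Q"
  shows "sigma11 (\<lambda>x::'a::topological_space. P x \<and> Q x)"
proof -
  have "sigma11 (\<lambda>x. \<forall>k::nat. case_nat P (\<lambda>_. Q) k x)"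
    by (rule sigma11_all) (simp add: assms split: nat.split)
  moreover have "(\<lambda>x. \<forall>k::nat. case_nat P (\<lambda>_. Q) k x) = (\<lambda>x. P x \<and> Q x)"
    by (intro ext) (metis nat.case nat.exhaust)
  ultimately show ?thesis by simp
qed

lemma sigma11_disj:
  assumes "sigma11 P" "sigma11 Q"
  shows "sigma11 (\<lambda>x::'a::topological_space. P x \<or> Q x)"
proof -
  have "sigma11 (\<lambda>x. \<exists>k::nat. case_nat P (\<lambda>_. Q) k x)"
    by (rule sigma11_ex) (simp add: assms split: nat.split)
  moreover have "(\<lambda>x. \<exists>k::nat. case_nat P (\<lambda>_. Q) k x) = (\<lambda>x. P x \<or> Q x)"
    by (intro ext) (metis nat.case nat.exhaust)
  ultimately show ?thesis by simp
qed

text \<open>The real \<open>g\<close> and the witness for it are interleaved on the even and odd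
  positions of one function.\<close>

lemma sigma11_ex_real:
  assumes "sigma11 (\<lambda>z. P (fst z) (snd z))"
  shows "sigma11 (\<lambda>x::'a::topological_space. \<exists>g::nat \<Rightarrow> nat. P x g)"
proof -
  obtain C where C: "closed C" "\<And>x g. P x g \<longleftrightarrow> (\<exists>f::nat \<Rightarrow> nat. ((x, g), f) \<in> C)"
    using assms unfolding sigma11_def by auto
  define h where "h = (\<lambda>z::'a \<times> (nat \<Rightarrow> nat). ((fst z, \<lambda>n. snd z (2 * n)), \<lambda>n. snd z (2 * n + 1)))"
  have h: "continuous_on UNIV h"
    unfolding h_def
    by (intro continuous_intros continuous_on_product_then_coordinatewise[of UNIV snd])
  from closed_vimage[OF C(1) h] show ?thesis
  proof (rule sigma11I)
    fix x
    show "(\<exists>g. P x g) \<longleftrightarrow> (\<exists>f. (x, f) \<in> h -` C)"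
    proof
      assume "\<exists>g. P x g"
      then obtain g f where g: "((x, g), f) \<in> C" using C(2) by metis
      have "(x, \<lambda>n. if even n then g (n div 2) else f (n div 2)) \<in> h -` C"
        using g by (simp add: h_def)
      then show "\<exists>f. (x, f) \<in> h -` C" by blast
    qed (use C(2) in \<open>auto simp: h_def\<close>)
  qed
qed

text \<open>A quantifier over a continuous image of Baire space reduces to one over Baire space. It
  is used for sets and for sequences of sets of naturals.\<close>

lemma sigma11_ex_via:
  fixes h :: "(nat \<Rightarrow> nat) \<Rightarrow> 'b::topological_space" and P :: "'a::topological_space \<Rightarrow> 'b \<Rightarrow> bool"
  assumes "sigma11 (\<lambda>z. P (fst z) (snd z))" "continuous_on UNIV h" "surj h"
  shows "sigma11 (\<lambda>x. \<exists>y. P x y)"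
proof -
  have "sigma11 (\<lambda>x. \<exists>g. P x (h g))"
  proof (rule sigma11_ex_real)
    have "continuous_on UNIV (\<lambda>z::'a \<times> (nat \<Rightarrow> nat). (fst z, h (snd z)))"
      by (intro continuous_intros continuous_on_compose2[OF assms(2)]) auto
    from sigma11_subst[OF assms(1) this] show "sigma11 (\<lambda>z. P (fst z) (h (snd z)))" by simp
  qed
  moreover have "(\<exists>g. P x (h g)) \<longleftrightarrow> (\<exists>y. P x y)" for x
    using assms(3) by (metis surjD)
  ultimately show ?thesis by simp
qed

lemma sigma11_ex_set:
  assumes "sigma11 (\<lambda>z. P (fst z) (snd z))"
  shows "sigma11 (\<lambda>x::'a::topological_space. \<exists>y::nat \<Rightarrow> bool. P x y)"
proof (rule sigma11_ex_via[OF assms])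
  show "continuous_on UNIV (\<lambda>f n. f n \<noteq> (0::nat))"
    by (rule continuous_on_coordinatewise_then_product, rule continuous_on_discrete_unary) simp
  show "surj (\<lambda>f n. f n \<noteq> (0::nat))"
    by (rule surjI[of _ "\<lambda>y n. of_bool (y n)"]) simp
qed

lemma sigma11_ex_seq:
  assumes "sigma11 (\<lambda>z. P (fst z) (snd z))"
  shows "sigma11 (\<lambda>x::'a::topological_space. \<exists>y::nat \<Rightarrow> nat \<Rightarrow> bool. P x y)"
proof (rule sigma11_ex_via[OF assms])
  show "continuous_on UNIV (\<lambda>f k n. f (prod_encode (k, n)) \<noteq> (0::nat))"
    by (rule continuous_on_coordinatewise_then_product, rule continuous_on_coordinatewise_then_product,
        rule continuous_on_discrete_unary) simp
  show "surj (\<lambda>f k n. f (prod_encode (k, n)) \<noteq> (0::nat))"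
    by (rule surjI[of _ "\<lambda>y n. of_bool (y (fst (prod_decode n)) (snd (prod_decode n)))"]) simp
qed

lemma tendsto_fun_componentwise:
  fixes l :: "'a \<Rightarrow> 'b::topological_space"
  assumes "\<And>i. ((\<lambda>c. f c i) \<longlongrightarrow> l i) F"
  shows "(f \<longlongrightarrow> l) F"
  using assms limitin_componentwise[of "\<lambda>_. euclidean" UNIV f l F]
  by (simp add: euclidean_product_topology)

text \<open>\<open>T\<close> collects the pairs of initial segments of points of \<open>C\<close>.
  If all initial segments of a point lie in \<open>T\<close>, the point is a limit of points of
  \<open>C\<close>, hence in \<open>C\<close>.\<close>

lemma analytic_if_sigma11:
  assumes "sigma11 P"
  shows "analytic {x. P (\<lambda>i. i \<in> x)}"
proof -
  obtain C where C: "closed C" "\<And>x. P x \<longleftrightarrow> (\<exists>f::nat \<Rightarrow> nat. (x, f) \<in> C)"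
    using assms unfolding sigma11_def by blast
  define T where "T = {(map x [0..<n], map f [0..<n]) | x f n. (x, f) \<in> C}"
  have "P (\<lambda>i. i \<in> x) \<longleftrightarrow> (\<exists>f. \<forall>n. (map (\<lambda>i. i \<in> x) [0..<n], map f [0..<n]) \<in> T)" for x
  proof
    assume "P (\<lambda>i. i \<in> x)"
    then obtain f where "(\<lambda>i. i \<in> x, f) \<in> C" using C(2) by blast
    then show "\<exists>f. \<forall>n. (map (\<lambda>i. i \<in> x) [0..<n], map f [0..<n]) \<in> T"
      unfolding T_def by blast
  next
    assume "\<exists>f. \<forall>n. (map (\<lambda>i. i \<in> x) [0..<n], map f [0..<n]) \<in> T"
    then obtain f where f: "\<And>n. (map (\<lambda>i. i \<in> x) [0..<n], map f [0..<n]) \<in> T" by blast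
    have "\<exists>y g. (y, g) \<in> C \<and> (\<forall>i<n. y i = (i \<in> x) \<and> g i = f i)" for n
    proof -
      obtain y g m where yg: "(y, g) \<in> C" "map (\<lambda>i. i \<in> x) [0..<n] = map y [0..<m]"
          "map f [0..<n] = map g [0..<m]"
        using f[of n] unfolding T_def by blast
      have "m = n" using arg_cong[OF yg(2), of length] by simp
      then show ?thesis using yg by (auto simp: map_eq_conv)
    qed
    then obtain y g where yg: "\<And>n. (y n, g n) \<in> C"
        "\<And>n i. i < n \<Longrightarrow> y n i = (i \<in> x) \<and> g n i = f i"
      by metis
    have "(y \<longlongrightarrow> (\<lambda>i. i \<in> x)) sequentially"
    proof (rule tendsto_fun_componentwise, rule tendsto_eventually)
      show "\<forall>\<^sub>F n in sequentially. y n i = (i \<in> x)" for i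
        using eventually_gt_at_top[of i] by eventually_elim (simp add: yg(2))
    qed
    moreover have "(g \<longlongrightarrow> f) sequentially"
    proof (rule tendsto_fun_componentwise, rule tendsto_eventually)
      show "\<forall>\<^sub>F n in sequentially. g n i = f i" for i
        using eventually_gt_at_top[of i] by eventually_elim (simp add: yg(2))
    qed
    ultimately have "(\<lambda>n. (y n, g n)) \<longlonglongrightarrow> (\<lambda>i. i \<in> x, f)"
      by (rule tendsto_Pair)
    then have "(\<lambda>i. i \<in> x, f) \<in> C"
      by (rule closed_sequentially[OF C(1) yg(1)])
    then show "P (\<lambda>i. i \<in> x)" using C(2) by blast
  qed
  then show ?thesis unfolding analytic_def by blast
qed

subsection \<open>The ideal on a single set\<close>

text \<open>For infinite \<open>y\<close>, these are the \<open>x\<close> that contain O(sqrt n) of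
  the first n elements of \<open>y\<close>. Each fixed \<open>c\<close> gives a closed condition on
  \<open>x\<close>, so the ideal is F-sigma.\<close>

definition thin :: "nat set \<Rightarrow> nat set \<Rightarrow> bool" where
  "thin y x \<longleftrightarrow> (\<exists>c. \<forall>m. (card (x \<inter> y \<inter> {..<m}))\<^sup>2 \<le> c * card (y \<inter> {..<m}))"

lemma thin_mono: "thin y x \<Longrightarrow> x' \<subseteq> x \<Longrightarrow> thin y x'"
  unfolding thin_def
  by (meson card_mono finite_Int finite_lessThan Int_mono order_refl order_trans power2_nat_le_eq_le)

lemma thin_finite:
  assumes "finite (x \<inter> y)"
  shows "thin y x"
  unfolding thin_def
proof (intro exI allI)
  fix m
  have "card (x \<inter> y \<inter> {..<m}) \<le> card (x \<inter> y)" by (intro card_mono assms) auto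
  moreover have "card (x \<inter> y \<inter> {..<m}) \<le> card (y \<inter> {..<m})" by (intro card_mono) auto
  ultimately show "(card (x \<inter> y \<inter> {..<m}))\<^sup>2 \<le> card (x \<inter> y) * card (y \<inter> {..<m})"
    by (simp add: power2_eq_square mult_le_mono)
qed

lemma thin_Un:
  assumes "thin y a" "thin y b"
  shows "thin y (a \<union> b)"
proof -
  obtain c d where c: "\<And>m. (card (a \<inter> y \<inter> {..<m}))\<^sup>2 \<le> c * card (y \<inter> {..<m})"
    and d: "\<And>m. (card (b \<inter> y \<inter> {..<m}))\<^sup>2 \<le> d * card (y \<inter> {..<m})"
    using assms unfolding thin_def by blast
  show ?thesis unfolding thin_def
  proof (intro exI allI)
    fix m
    define A where "A = card (a \<inter> y \<inter> {..<m})"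
    define B where "B = card (b \<inter> y \<inter> {..<m})"
    have "card ((a \<union> b) \<inter> y \<inter> {..<m}) \<le> A + B"
      unfolding A_def B_def using card_Un_le[of "a \<inter> y \<inter> {..<m}" "b \<inter> y \<inter> {..<m}"]
      by (simp add: Int_Un_distrib2)
    then have "(card ((a \<union> b) \<inter> y \<inter> {..<m}))\<^sup>2 \<le> (A + B)\<^sup>2" by simp
    also have "\<dots> \<le> 2 * A\<^sup>2 + 2 * B\<^sup>2"
    proof -
      \<comment> \<open>The integers are needed because subtraction of naturals truncates.\<close>
      have "0 \<le> (int A - int B)\<^sup>2" by simp
      then have "int ((A + B)\<^sup>2) \<le> int (2 * A\<^sup>2 + 2 * B\<^sup>2)"
        by (simp add: power2_sum power2_diff)
      then show ?thesis by (simp only: of_nat_le_iff)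
    qed
    also have "\<dots> \<le> 2 * (c * card (y \<inter> {..<m})) + 2 * (d * card (y \<inter> {..<m}))"
      using c[of m] d[of m] unfolding A_def B_def by linarith
    also have "\<dots> = (2 * c + 2 * d) * card (y \<inter> {..<m})" by (simp add: algebra_simps)
    finally show "(card ((a \<union> b) \<inter> y \<inter> {..<m}))\<^sup>2 \<le> (2 * c + 2 * d) * card (y \<inter> {..<m})" .
  qed
qed

lemma card_below_enumerate:
  fixes y :: "nat set"
  assumes "infinite y"
  shows "n \<le> card (y \<inter> {..<enumerate y n})"
proof -
  have "enumerate y ` {..<n} \<subseteq> y \<inter> {..<enumerate y n}"
    using assms by (auto simp: enumerate_in_set enumerate_mono)
  then have "card (enumerate y ` {..<n}) \<le> card (y \<inter> {..<enumerate y n})"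
    by (intro card_mono) auto
  moreover have "inj_on (enumerate y) {..<n}"
    using assms strict_mono_enumerate strict_mono_imp_inj_on inj_on_subset by blast
  ultimately show ?thesis by (simp add: card_image)
qed

text \<open>Once \<open>y\<close> has more than \<open>c\<close> elements below \<open>m\<close>,
  the bound with constant \<open>c\<close> fails at \<open>m\<close>.\<close>

lemma not_thin_self:
  assumes "infinite y"
  shows "\<not> thin y y"
proof
  assume "thin y y"
  then obtain c where c: "\<And>m. (card (y \<inter> {..<m}))\<^sup>2 \<le> c * card (y \<inter> {..<m})"
    unfolding thin_def by auto
  define m where "m = enumerate y (Suc c)"
  have "Suc c \<le> card (y \<inter> {..<m})"
    unfolding m_def by (rule card_below_enumerate[OF assms])
  moreover have "card (y \<inter> {..<m}) \<le> c"
    using c[of m] calculation by (simp add: power2_eq_square)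
  ultimately show False by simp
qed

text \<open>Keeping only the elements of \<open>x\<close> at square positions brings the count down
  to a square root.\<close>

lemma ex_infinite_thin_subset:
  assumes "infinite x" "x \<subseteq> y"
  shows "\<exists>z \<subseteq> x. infinite z \<and> thin y z"
proof -
  \<comment> \<open>The shift to \<open>Suc k\<close> matters: at most \<open>k + 1\<close> kept
    elements occur up to \<open>e k\<close>, and at least \<open>(k + 1)^2\<close> elements of
    \<open>x\<close> lie below it, so the constant 1 suffices.\<close>
  define e where "e k = enumerate x ((Suc k)\<^sup>2)" for k
  have inj: "inj e"
    unfolding e_def using strict_mono_enumerate[OF assms(1)]
    by (intro injI) (simp add: strict_mono_eq power2_eq_iff_nonneg)
  have sub: "range e \<subseteq> x" unfolding e_def using enumerate_in_set[OF assms(1)] by blast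
  have "(card (range e \<inter> y \<inter> {..<m}))\<^sup>2 \<le> 1 * card (y \<inter> {..<m})" for m
  proof (cases "range e \<inter> y \<inter> {..<m} = {}")
    case False
    define K where "K = {k. e k < m}"
    have E: "range e \<inter> y \<inter> {..<m} = e ` K" using sub assms(2) unfolding K_def by blast
    then have finK: "finite K"
      using finite_imageD[of e K] inj by (metis finite_Int finite_lessThan inj_on_subset subset_UNIV)
    have neK: "K \<noteq> {}" using False E by auto
    have "K \<subseteq> {..Max K}" using finK by auto
    then have "card K \<le> Suc (Max K)" using card_mono[of "{..Max K}" K] by simp
    then have "(card (range e \<inter> y \<inter> {..<m}))\<^sup>2 \<le> (Suc (Max K))\<^sup>2"
      unfolding E by (meson card_image_le finK order_trans power2_nat_le_eq_le)
    also have "\<dots> \<le> card (x \<inter> {..<e (Max K)})"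
      unfolding e_def by (rule card_below_enumerate[OF assms(1)])
    also have "\<dots> \<le> card (y \<inter> {..<m})"
    proof (rule card_mono)
      show "x \<inter> {..<e (Max K)} \<subseteq> y \<inter> {..<m}"
        using Max_in[OF finK neK] assms(2) unfolding K_def by auto
    qed simp
    finally show ?thesis by simp
  qed simp
  then have "thin y (range e)" unfolding thin_def by blast
  then show ?thesis using sub inj finite_imageD by blast
qed

subsection \<open>Homogeneous sets for fronts\<close>

text \<open>Stems grow only by positive elements: \<^const>\<open>init_seg\<close> allows the empty set to belong to a
  front, as an initial segment of the sets not containing 0.\<close>

inductive bar :: "nat set set \<Rightarrow> nat set \<Rightarrow> bool" for B where
  bar_leaf: "s \<in> B \<Longrightarrow> bar B s"
| bar_step: "s \<notin> B \<Longrightarrow> (\<And>n. \<forall>k\<in>insert 0 s. k < n \<Longrightarrow> bar B (insert n s)) \<Longrightarrow> bar B s"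

text \<open>Otherwise choice extends the empty stem forever outside \<open>bar\<close>. The infinite
  set of chosen elements has an initial segment in \<open>B\<close>, which is one of the stems, a
  contradiction.\<close>

lemma front_bar:
  assumes "front_on B UNIV"
  shows "bar B {}"
proof (rule ccontr)
  assume nb: "\<not> bar B {}"
  define ok where "ok s n \<longleftrightarrow> (\<forall>k\<in>insert 0 s. k < n) \<and> \<not> bar B (insert n s)" for s n
  define S where "S = rec_nat {} (\<lambda>_ s. insert (SOME n. ok s n) s)"
  define N where "N k = (SOME n. ok (S k) n)" for k
  have S0: "S 0 = {}" and SS: "S (Suc k) = insert (N k) (S k)" for k
    by (simp_all add: S_def N_def)
  have ok: "ok s (SOME n. ok s n)" if "\<not> bar B s" for s
  proof -
    have "s \<notin> B" using that bar_leaf by blast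
    then have "\<exists>n. ok s n" using that bar_step[of s B] unfolding ok_def by blast
    then show ?thesis by (rule someI_ex)
  qed
  have nbS: "\<not> bar B (S k)" for k
  proof (induction k)
    case (Suc k)
    then show ?case using ok[of "S k"] unfolding SS N_def ok_def by blast
  qed (simp add: S0 nb)
  have okN: "ok (S k) (N k)" for k unfolding N_def by (rule ok[OF nbS])
  have SN: "S k = N ` {..<k}" for k
    by (induction k) (simp_all add: S0 SS lessThan_Suc)
  have less: "N j < N k" if "j < k" for j k
    using okN[of k] that unfolding ok_def SN by auto
  then have sm: "strict_mono N" by (simp add: strict_mono_def)
  then have "infinite (range N)" using finite_imageD strict_mono_imp_inj_on by blast
  moreover have "\<forall>y. y \<subseteq> UNIV \<and> infinite y \<longrightarrow> (\<exists>s\<in>B. init_seg s y)"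
    using assms unfolding front_on_def by (elim conjE)
  ultimately obtain s m where s: "s \<in> B" "s = range N \<inter> {0..m}"
    unfolding init_seg_def by (metis subset_UNIV)
  \<comment> \<open>\<open>K\<close> is the number of chosen elements up to \<open>m\<close>, so the
    cut at \<open>m\<close> is the stem \<open>S K\<close>. The case \<open>K = 0\<close> covers an
    empty member of the front.\<close>
  define K where "K = (LEAST k. m < N k)"
  have "m < N (Suc m)" using strict_mono_imp_increasing[OF sm, of "Suc m"] by simp
  then have K: "m < N K" unfolding K_def by (rule LeastI)
  have iff: "N k \<le> m \<longleftrightarrow> k < K" for k
  proof
    assume "N k \<le> m"
    then show "k < K" using K sm by (metis le_less_trans strict_mono_less)
  next
    assume "k < K"
    then show "N k \<le> m" unfolding K_def using not_less_Least by (metis not_less)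
  qed
  have "range N \<inter> {0..m} = N ` {k. N k \<le> m}" by (simp add: set_eq_iff image_iff) metis
  also have "{k. N k \<le> m} = {..<K}" by (simp add: set_eq_iff iff)
  finally have "range N \<inter> {0..m} = N ` {..<K}" .
  then have "s = S K" using s(2) SN by simp
  then show False using nbS[of K] s(1) bar_leaf by metis
qed

text \<open>Cutting \<open>s \<union> u\<close> at the maximum of \<open>insert 0 s\<close> gives
  back \<open>s\<close>, so the antichain condition applies. The added 0 makes the maximum exist for
  empty \<open>s\<close>, where \<open>u\<close> still avoids 0.\<close>

lemma front_extension_eq:
  assumes "front_on B UNIV" "s \<in> B" "s \<union> u \<in> B" "\<And>m. m \<in> u \<Longrightarrow> \<forall>k\<in>insert 0 s. k < m"
  shows "u = {}"
proof -
  have antichain: "\<forall>s\<in>B. \<forall>t\<in>B. s \<noteq> t \<longrightarrow> \<not> init_seg s t \<and> \<not> init_seg t s"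
    using assms(1) unfolding front_on_def by (elim conjE)
  have fin: "finite (insert 0 s)" using assms(1,2) by (simp add: front_on_def)
  define m where "m = Max (insert 0 s)"
  have "s \<subseteq> {0..m}" unfolding m_def using fin Max_ge by auto
  moreover have "u \<inter> {0..m} = {}"
    using assms(4) Max_in[OF fin] unfolding m_def by fastforce
  ultimately have "s = (s \<union> u) \<inter> {0..m}" by blast
  then have "init_seg s (s \<union> u)" unfolding init_seg_def by blast
  then have "s = s \<union> u" using antichain assms(2,3) by metis
  then show ?thesis using assms(4) by blast
qed

section \<open>The fusion step of Nash-Williams' theorem\<close>

text \<open>Admissible reservoirs for the stem \<open>s\<close>. They are characteristic functions,
  so that they are points of a product space.\<close>

definition good :: "nat set \<Rightarrow> (nat \<Rightarrow> bool) \<Rightarrow> bool" where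
  "good s x \<longleftrightarrow> infinite {m. x m} \<and> (\<forall>m. x m \<longrightarrow> (\<forall>k\<in>insert 0 s. k < m))"

text \<open>A colouring of finite sets becomes a point of the Cantor space through
  \<open>set_encode\<close>; \<open>i\<close> is the constant colour.\<close>

definition homog_above :: "nat set set \<Rightarrow> (nat \<Rightarrow> bool) \<Rightarrow> nat set \<Rightarrow> (nat \<Rightarrow> bool) \<Rightarrow> bool \<Rightarrow> bool" where
  "homog_above B F s y i \<longleftrightarrow>
    (\<forall>u. finite u \<longrightarrow> u \<subseteq> {m. y m} \<longrightarrow> s \<union> u \<in> B \<longrightarrow> F (set_encode (s \<union> u)) = i)"

definition tail :: "(nat \<Rightarrow> bool) \<Rightarrow> nat \<Rightarrow> bool" where
  "tail x m \<longleftrightarrow> x m \<and> (LEAST n. x n) < m"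

text \<open>A relation in place of \<open>LEAST\<close>, so that its logical complexity is
  visible.\<close>

definition is_least :: "(nat \<Rightarrow> bool) \<Rightarrow> nat \<Rightarrow> bool" where
  "is_least x n \<longleftrightarrow> x n \<and> (\<forall>m. m < n \<longrightarrow> \<not> x m)"

lemma is_least_iff: "good s x \<Longrightarrow> is_least x n \<longleftrightarrow> n = (LEAST n. x n)"
proof -
  assume "good s x"
  then have "\<exists>n. x n" unfolding good_def by (metis Collect_empty_eq infinite_imp_nonempty)
  then have "x (LEAST n. x n)" by (metis LeastI_ex)
  then show ?thesis unfolding is_least_def
    by (metis linorder_neqE_nat not_less_Least)
qed

lemma good_tail:
  assumes "good s x"
  shows "x (LEAST n. x n)" and "\<forall>k\<in>insert 0 s. k < (LEAST n. x n)"
    and "good (insert (LEAST n. x n) s) (tail x)"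
proof -
  show 1: "x (LEAST n. x n)" using is_least_iff[OF assms] is_least_def by blast
  then show "\<forall>k\<in>insert 0 s. k < (LEAST n. x n)" using assms unfolding good_def by blast
  have "{m. x m} \<subseteq> {m. tail x m} \<union> {..LEAST n. x n}" unfolding tail_def by auto
  then have "infinite {m. tail x m}"
    using assms unfolding good_def by (metis finite_Un finite_atMost finite_subset)
  then show "good (insert (LEAST n. x n) s) (tail x)"
    using assms unfolding good_def tail_def by auto
qed

text \<open>Stage \<open>k\<close> removes the least element \<open>N k\<close> of the reservoir and
  shrinks the rest until the stem \<open>insert (N k) s\<close> has one colour \<open>c k\<close>.
  The set \<open>y\<close> keeps the \<open>N k\<close> whose colour is \<open>i\<close>, one that
  recurs infinitely often. The colour of a member of \<open>B\<close> is then decided by the first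
  element it takes from \<open>y\<close>.\<close>

lemma homogeneous_diagonal:
  fixes X :: "nat \<Rightarrow> nat \<Rightarrow> bool" and c :: "nat \<Rightarrow> bool"
  defines "N \<equiv> \<lambda>k. LEAST n. X k n"
  assumes X: "\<And>k. good s (X k)" "\<And>k m. X (Suc k) m \<Longrightarrow> tail (X k) m"
    and h: "\<And>k. homog_above B F (insert (N k) s) (X (Suc k)) (c k)"
    and s: "s \<notin> B"
    and i: "i \<longleftrightarrow> (\<forall>a. \<exists>b>a. c b)"
    and y: "\<And>m. y m \<longleftrightarrow> (\<exists>k. N k = m \<and> c k = i)"
  shows "good s y \<and> y \<le> X 0 \<and> homog_above B F s y i"
proof -
  have mono: "X k m \<Longrightarrow> X j m" if "j \<le> k" for j k m
    using that by (induction k rule: dec_induct) (use X(2) tail_def in blast)+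
  have NX: "X k (N k)" for k unfolding N_def by (rule good_tail(1)[OF X(1)])
  have less: "N j < N k" if "j < k" for j k
    using X(2) mono[of "Suc j" k "N k"] NX[of k] that unfolding N_def tail_def by (metis Suc_leI)
  then have inj: "inj N" by (metis linorder_injI less_irrefl)
  \<comment> \<open>If \<open>True\<close> does not recur, then \<open>i\<close> is
    \<open>False\<close> and all but finitely many colours equal it.\<close>
  have "infinite {k. c k = i}"
  proof (cases i)
    case True
    then show ?thesis using i unfolding infinite_nat_iff_unbounded by simp
  next
    case False
    then obtain a where "\<And>b. a < b \<Longrightarrow> \<not> c b" using i by blast
    then have "{a<..} \<subseteq> {k. c k = i}" using False by auto
    then show ?thesis using infinite_Ioi infinite_super by blast
  qed
  moreover have Y: "{m. y m} = N ` {k. c k = i}" using y by auto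
  ultimately have inf: "infinite {m. y m}"
    using inj finite_imageD inj_on_subset by (metis subset_UNIV)
  have yX: "y \<le> X 0" using y NX mono[of 0] by (auto simp: le_fun_def)
  then have "good s y" using inf X(1)[of 0] unfolding good_def by (auto simp: le_fun_def)
  moreover have "F (set_encode (s \<union> u)) = i" if u: "finite u" "u \<subseteq> {m. y m}" "s \<union> u \<in> B" for u
  proof -
    \<comment> \<open>Here \<open>s \<notin> B\<close> enters: it guarantees that \<open>u\<close>
      has a minimum.\<close>
    have "u \<noteq> {}" using u(3) s by auto
    then have M: "Min u \<in> u" by (rule Min_in[OF u(1)])
    then obtain k where k: "N k = Min u" "c k = i" using u(2) y by blast
    \<comment> \<open>The other elements of \<open>u\<close> were chosen at later stages, hence from
      the reservoir left after stage \<open>k\<close>.\<close>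
    have "X (Suc k) m" if m: "m \<in> u - {Min u}" for m
    proof -
      obtain l where l: "N l = m" using m u(2) y by blast
      have "N k < N l" using m Min_le[OF u(1), of m] k l by auto
      then have "k < l" using less by (metis linorder_neqE_nat not_less_iff_gr_or_eq)
      then show ?thesis using mono[of "Suc k" l m] NX[of l] l by auto
    qed
    moreover have "insert (N k) s \<union> (u - {Min u}) = s \<union> u" using M k by auto
    ultimately show ?thesis
      using h[of k] u k(2) unfolding homog_above_def
      by (metis (no_types, lifting) finite_Diff mem_Collect_eq subsetI)
  qed
  ultimately show ?thesis using yX unfolding homog_above_def by blast
qed

section \<open>Complexity of the fusion step\<close>

lemma sigma11_coordinate:
  assumes "continuous_on UNIV f"
  shows "sigma11 (\<lambda>x::'a::topological_space. f x (n::nat))"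
    and "sigma11 (\<lambda>x::'a::topological_space. \<not> f x (n::nat))"
  using continuous_on_product_then_coordinatewise[OF assms, of n]
  by (auto intro: sigma11_clopen continuous_on_neg)

lemma sigma11_const: "sigma11 (\<lambda>x. b)"
  by (rule sigma11_clopen) simp

lemma sigma11_imp_const:
  assumes "b \<Longrightarrow> sigma11 P"
  shows "sigma11 (\<lambda>x. b \<longrightarrow> P x)"
  using assms by (cases b) (simp_all add: sigma11_const)

lemma sigma11_is_least:
  assumes "continuous_on UNIV f"
  shows "sigma11 (\<lambda>x::'a::topological_space. is_least (f x) n)"
  unfolding is_least_def
  by (intro sigma11_conj sigma11_all sigma11_imp_const sigma11_coordinate assms)

text \<open>Analytic predicates are not closed under negation in general, so the negation is written
  out as a search.\<close>

lemma sigma11_not_is_least: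
  assumes "continuous_on UNIV f"
  shows "sigma11 (\<lambda>x::'a::topological_space. \<not> is_least (f x) n)"
proof -
  have "sigma11 (\<lambda>x. \<not> f x n \<or> (\<exists>m. m < n \<and> f x m))"
    by (intro sigma11_disj sigma11_ex sigma11_conj sigma11_const sigma11_coordinate assms)
  then show ?thesis unfolding is_least_def by simp
qed

type_synonym point = "(nat \<Rightarrow> bool) \<times> (nat \<Rightarrow> bool) \<times> (nat \<Rightarrow> bool) \<times> bool"

text \<open>\<open>X\<close> and \<open>c\<close> record a run of the fusion from reservoir
  \<open>x\<close> to result \<open>y\<close> with colour \<open>i\<close>; \<open>R n\<close>
  stands for the graph of the selection at the stem enlarged by \<open>n\<close>. \<open>R\<close>
  occurs only positively.\<close>

definition diagonal_step ::
  "(nat \<Rightarrow> point \<Rightarrow> bool) \<Rightarrow> point \<Rightarrow> (nat \<Rightarrow> nat \<Rightarrow> bool) \<Rightarrow> (nat \<Rightarrow> bool) \<Rightarrow> bool" where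
  "diagonal_step R = (\<lambda>(F, x, y, i) X c.
    (\<forall>m. X 0 m \<longleftrightarrow> x m) \<and>
    (\<forall>k. \<exists>n. is_least (X k) n \<and> R n (F, \<lambda>m. X k m \<and> n < m, X (Suc k), c k)) \<and>
    (i \<longleftrightarrow> (\<forall>a. \<exists>b>a. c b)) \<and>
    (\<forall>m. y m \<longleftrightarrow> (\<exists>k. is_least (X k) m \<and> c k = i)))"

text \<open>The run is guessed existentially; checking it takes only number quantifiers over clopen
  conditions and instances of \<open>R\<close>.\<close>

lemma sigma11_diagonal_step:
  assumes R: "\<And>n. sigma11 (R n)"
  shows "sigma11 (\<lambda>z. \<exists>X c. diagonal_step R z X c)"
proof (rule sigma11_ex_seq, rule sigma11_ex_set)
  define F where "F = (\<lambda>w::(point \<times> (nat \<Rightarrow> nat \<Rightarrow> bool)) \<times> (nat \<Rightarrow> bool). fst (fst (fst w)))"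
  define x where "x = (\<lambda>w::(point \<times> (nat \<Rightarrow> nat \<Rightarrow> bool)) \<times> (nat \<Rightarrow> bool). fst (snd (fst (fst w))))"
  define y where "y = (\<lambda>w::(point \<times> (nat \<Rightarrow> nat \<Rightarrow> bool)) \<times> (nat \<Rightarrow> bool). fst (snd (snd (fst (fst w)))))"
  define i where "i = (\<lambda>w::(point \<times> (nat \<Rightarrow> nat \<Rightarrow> bool)) \<times> (nat \<Rightarrow> bool). snd (snd (snd (fst (fst w)))))"
  define X where "X = (\<lambda>w::(point \<times> (nat \<Rightarrow> nat \<Rightarrow> bool)) \<times> (nat \<Rightarrow> bool). snd (fst w))"
  define c where "c = (\<lambda>w::(point \<times> (nat \<Rightarrow> nat \<Rightarrow> bool)) \<times> (nat \<Rightarrow> bool). snd w)"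
  have cont: "continuous_on UNIV F" "continuous_on UNIV x" "continuous_on UNIV y"
      "continuous_on UNIV i" "continuous_on UNIV X" "continuous_on UNIV c"
    unfolding F_def x_def y_def i_def X_def c_def by (intro continuous_intros)+
  have Xk: "continuous_on UNIV (\<lambda>w. X w k)" and ck: "continuous_on UNIV (\<lambda>w. c w k)"
    and xk: "continuous_on UNIV (\<lambda>w. x w k)" and yk: "continuous_on UNIV (\<lambda>w. y w k)" for k
    by (intro continuous_on_product_then_coordinatewise[OF cont(5)]
        continuous_on_product_then_coordinatewise[OF cont(6)]
        continuous_on_product_then_coordinatewise[OF cont(2)]
        continuous_on_product_then_coordinatewise[OF cont(3)])+
  have Xkm: "continuous_on UNIV (\<lambda>w. X w k m)" for k m
    by (rule continuous_on_product_then_coordinatewise[OF Xk])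
  have i: "sigma11 i" "sigma11 (\<lambda>w. \<not> i w)"
    by (intro sigma11_clopen continuous_on_neg cont)+
  have cki: "sigma11 (\<lambda>w. c w k = i w)" "sigma11 (\<lambda>w. c w k \<noteq> i w)" for k
    by (intro sigma11_clopen continuous_on_neg continuous_on_iff_pred ck cont)+
  \<comment> \<open>The last two equivalences are split into their both-true and both-false cases,
    since only conjunctions, disjunctions and quantifiers are available.\<close>
  have "sigma11 (\<lambda>w. (\<forall>m. X w 0 m \<longleftrightarrow> x w m) \<and>
     (\<forall>k. \<exists>n. is_least (X w k) n \<and> R n (F w, \<lambda>m. X w k m \<and> n < m, X w (Suc k), c w k)) \<and>
     ((i w \<and> (\<forall>a. \<exists>b. a < b \<and> c w b)) \<or> (\<not> i w \<and> (\<exists>a. \<forall>b. a < b \<longrightarrow> \<not> c w b))) \<and>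
     (\<forall>m. (y w m \<and> (\<exists>k. is_least (X w k) m \<and> c w k = i w)) \<or>
          (\<not> y w m \<and> (\<forall>k. \<not> is_least (X w k) m \<or> c w k \<noteq> i w))))" (is "sigma11 ?M")
  proof -
    have "sigma11 (\<lambda>w. \<forall>m. X w 0 m \<longleftrightarrow> x w m)"
      by (intro sigma11_all sigma11_clopen continuous_on_iff_pred Xkm xk)
    moreover have "sigma11 (\<lambda>w. R n (F w, \<lambda>m. X w k m \<and> n < m, X w (Suc k), c w k))" for n k
    proof (rule sigma11_subst[OF R])
      have "continuous_on UNIV (\<lambda>w m. X w k m \<and> n < m)"
        by (intro continuous_on_coordinatewise_then_product continuous_on_conj Xkm) simp
      then show "continuous_on UNIV (\<lambda>w. (F w, \<lambda>m. X w k m \<and> n < m, X w (Suc k), c w k))"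
        by (intro continuous_on_Pair cont(1) Xk ck)
    qed
    then have "sigma11 (\<lambda>w. \<forall>k. \<exists>n. is_least (X w k) n \<and>
        R n (F w, \<lambda>m. X w k m \<and> n < m, X w (Suc k), c w k))"
      by (intro sigma11_all sigma11_ex sigma11_conj sigma11_is_least Xk)
    moreover have "sigma11 (\<lambda>w. (i w \<and> (\<forall>a. \<exists>b. a < b \<and> c w b)) \<or>
        (\<not> i w \<and> (\<exists>a. \<forall>b. a < b \<longrightarrow> \<not> c w b)))"
      by (intro sigma11_disj sigma11_conj i sigma11_all sigma11_ex sigma11_const sigma11_imp_const
          sigma11_coordinate cont)
    moreover have "sigma11 (\<lambda>w. \<forall>m. (y w m \<and> (\<exists>k. is_least (X w k) m \<and> c w k = i w)) \<or>
          (\<not> y w m \<and> (\<forall>k. \<not> is_least (X w k) m \<or> c w k \<noteq> i w)))"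
      by (intro sigma11_all sigma11_disj sigma11_conj sigma11_ex cki sigma11_is_least
          sigma11_not_is_least Xk sigma11_coordinate cont)
    ultimately show ?thesis by (intro sigma11_conj)
  qed
  moreover have "?M = (\<lambda>w. diagonal_step R (fst (fst w)) (snd (fst w)) (snd w))"
    unfolding diagonal_step_def F_def x_def y_def i_def X_def c_def
    by (rule ext) (simp add: split_beta, blast)
  ultimately show "sigma11 (\<lambda>w. diagonal_step R (fst (fst w)) (snd (fst w)) (snd w))" by simp
qed

section \<open>Selecting homogeneous sets with analytic graph\<close>

text \<open>\<open>R\<close> defines the graph of \<open>\<phi>\<close> only on good reservoirs, but
  must be analytic everywhere.\<close>

definition selector :: "nat set set \<Rightarrow> nat set
    \<Rightarrow> ((nat \<Rightarrow> bool) \<Rightarrow> (nat \<Rightarrow> bool) \<Rightarrow> (nat \<Rightarrow> bool) \<times> bool) \<Rightarrow> (point \<Rightarrow> bool) \<Rightarrow> bool" where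
  "selector B s \<phi> R \<longleftrightarrow> sigma11 R \<and> (\<forall>F x. good s x \<longrightarrow>
     good s (fst (\<phi> F x)) \<and> fst (\<phi> F x) \<le> x \<and> homog_above B F s (fst (\<phi> F x)) (snd (\<phi> F x)) \<and>
     (\<forall>y i. R (F, x, y, i) \<longleftrightarrow> \<phi> F x = (y, i)))"

text \<open>At a stem in \<open>B\<close> the reservoir itself works: by the antichain condition
  only \<open>u = {}\<close> gives a member of \<open>B\<close>, so the only colour is that of
  \<open>s\<close>.\<close>

lemma selector_leaf:
  assumes "front_on B UNIV" "s \<in> B"
  shows "\<exists>\<phi> R. selector B s \<phi> R"
proof (intro exI)
  define R :: "point \<Rightarrow> bool" where
    "R = (\<lambda>(F, x, y, i). (\<forall>m. y m \<longleftrightarrow> x m) \<and> i = F (set_encode s))"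
  have "sigma11 (\<lambda>w::point. (\<forall>m. fst (snd (snd w)) m \<longleftrightarrow> fst (snd w) m)
      \<and> snd (snd (snd w)) = fst w (set_encode s))"
    by (intro sigma11_conj sigma11_all sigma11_clopen continuous_on_iff_pred continuous_intros
        continuous_on_product_then_coordinatewise[of UNIV fst]
        continuous_on_product_then_coordinatewise[of UNIV "\<lambda>w. fst (snd w)"]
        continuous_on_product_then_coordinatewise[of UNIV "\<lambda>w. fst (snd (snd w))"])
  also have "(\<lambda>w::point. (\<forall>m. fst (snd (snd w)) m \<longleftrightarrow> fst (snd w) m)
      \<and> snd (snd (snd w)) = fst w (set_encode s)) = R"
    unfolding R_def by auto
  finally have "sigma11 R" .
  moreover have "homog_above B F s x (F (set_encode s))" if "good s x" for F x
    unfolding homog_above_def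
  proof (intro allI impI)
    fix u assume "u \<subseteq> {m. x m}" "s \<union> u \<in> B"
    then have "u = {}" using front_extension_eq[OF assms, of u] that unfolding good_def by blast
    then show "F (set_encode (s \<union> u)) = F (set_encode s)" by simp
  qed
  moreover have "R (F, x, y, i) \<longleftrightarrow> (x, F (set_encode s)) = (y, i)" for F x y i
    unfolding R_def by (auto simp: fun_eq_iff)
  ultimately show "selector B s (\<lambda>F x. (x, F (set_encode s))) R"
    unfolding selector_def by simp
qed

lemma good_insert: "good (insert n s) x \<Longrightarrow> good s x"
  unfolding good_def by simp

text \<open>The selectors for the enlarged stems are iterated along the fusion; a run of
  \<open>diagonal_step\<close> defines the graph of the result.\<close>

lemma selector_step:
  assumes s: "s \<notin> B"
    and IH: "\<And>n. \<forall>k\<in>insert 0 s. k < n \<Longrightarrow> \<exists>\<phi> R. selector B (insert n s) \<phi> R"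
  shows "\<exists>\<phi> R. selector B s \<phi> R"
proof -
  obtain \<phi> R where sel: "\<And>n. \<forall>k\<in>insert 0 s. k < n \<Longrightarrow> selector B (insert n s) (\<phi> n) (R n)"
    using IH by metis
  \<comment> \<open>For \<open>n\<close> not above the stem no selector is given; the empty relation
    keeps every \<open>R' n\<close> analytic.\<close>
  define R' where "R' n = (if \<forall>k\<in>insert 0 s. k < n then R n else (\<lambda>_. False))" for n
  have R': "sigma11 (R' n)" for n
    using sel[of n] unfolding R'_def selector_def by (auto simp: sigma11_const)
  define N where "N x = (LEAST n. x n)" for x :: "nat \<Rightarrow> bool"
  define st where "st F x = \<phi> (N x) F (tail x)" for F x
  define X where "X F x = rec_nat x (\<lambda>_ x'. fst (st F x'))" for F x
  define c where "c F x k = snd (st F (X F x k))" for F x k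
  define i where "i F x \<longleftrightarrow> (\<forall>a. \<exists>b>a. c F x b)" for F x
  define y where "y F x m \<longleftrightarrow> (\<exists>k. N (X F x k) = m \<and> c F x k = i F x)" for F x m
  have X0: "X F x 0 = x" and XS: "X F x (Suc k) = fst (st F (X F x k))" for F x k
    by (simp_all add: X_def)
  have st: "good s (fst (st F x))" "fst (st F x) \<le> tail x"
      "homog_above B F (insert (N x) s) (fst (st F x)) (snd (st F x))"
      "R' (N x) (F, tail x, x', b) \<longleftrightarrow> st F x = (x', b)"
    if "good s x" for F x x' b
  proof -
    note g = good_tail[OF that, folded N_def]
    have R'N: "R' (N x) = R (N x)" using g(2) unfolding R'_def by simp
    show "good s (fst (st F x))" "fst (st F x) \<le> tail x"
      "homog_above B F (insert (N x) s) (fst (st F x)) (snd (st F x))"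
      "R' (N x) (F, tail x, x', b) \<longleftrightarrow> st F x = (x', b)"
      using sel[OF g(2)] g(3) good_insert[of "N x" s]
      unfolding selector_def st_def R'N by blast+
  qed
  have goodX: "good s (X F x k)" if "good s x" for F x k
    by (induction k) (use that X0 XS st(1) in auto)
  have tail_eq: "tail x = (\<lambda>m. x m \<and> N x < m)" for x
    unfolding tail_def N_def by blast
  have "good s (y F x) \<and> y F x \<le> x \<and> homog_above B F s (y F x) (i F x)" if "good s x" for F x
  proof -
    have "good s (y F x) \<and> y F x \<le> X F x 0 \<and> homog_above B F s (y F x) (i F x)"
    proof (rule homogeneous_diagonal[where c = "c F x"])
      show "tail (X F x k) m" if "X F x (Suc k) m" for k m
        using st(2)[OF goodX[OF \<open>good s x\<close>]] that unfolding XS by (auto simp: le_fun_def)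
      show "homog_above B F (insert (LEAST n. X F x k n) s) (X F x (Suc k)) (c F x k)" for k
        using st(3)[OF goodX[OF \<open>good s x\<close>]] unfolding XS c_def N_def by blast
    qed (use goodX[OF that] s i_def y_def N_def in auto)
    then show ?thesis by (simp add: X0)
  qed
  moreover have "(\<exists>X c. diagonal_step R' (F, x, z, b) X c) \<longleftrightarrow> (y F x, i F x) = (z, b)"
    if "good s x" for F x z b
  proof
    note least = is_least_iff[folded N_def]
    assume "\<exists>X c. diagonal_step R' (F, x, z, b) X c"
    then obtain X' c' where d: "diagonal_step R' (F, x, z, b) X' c'" by blast
    have X'0: "X' 0 = x" using d unfolding diagonal_step_def by auto
    \<comment> \<open>Each graph is single-valued on good reservoirs, so a guessed run agrees stage
      by stage with the one defined by recursion.\<close>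
    have step: "X' (Suc k) = fst (st F (X' k)) \<and> c' k = snd (st F (X' k))" if "good s (X' k)" for k
    proof -
      have "\<exists>n. is_least (X' k) n \<and> R' n (F, \<lambda>m. X' k m \<and> n < m, X' (Suc k), c' k)"
        using d unfolding diagonal_step_def by simp
      then obtain n where
        n: "is_least (X' k) n" "R' n (F, \<lambda>m. X' k m \<and> n < m, X' (Suc k), c' k)"
        by blast
      then have "n = N (X' k)" using least[OF that] by blast
      then have "st F (X' k) = (X' (Suc k), c' k)" using n(2) st(4)[OF that] tail_eq by metis
      then show ?thesis by simp
    qed
    have "X' k = X F x k" for k
    proof (induction k)
      case (Suc k)
      then show ?case using step[of k] goodX[OF that, of F k] XS by simp
    qed (simp add: X'0 X0)
    then have X': "X' = X F x" by blast
    have c': "c' = c F x" using step goodX[OF that] unfolding X' c_def by blast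
    have "b = i F x" using d unfolding diagonal_step_def i_def c' by simp
    moreover have "z = y F x"
      using d least[OF goodX[OF that]] unfolding diagonal_step_def y_def X' c' \<open>b = i F x\<close>
      by (auto simp: fun_eq_iff)
    ultimately show "(y F x, i F x) = (z, b)" by simp
  next
    note least = is_least_iff[OF goodX[OF that], folded N_def]
    assume "(y F x, i F x) = (z, b)"
    moreover have "diagonal_step R' (F, x, y F x, i F x) (X F x) (c F x)"
    proof -
      have "R' (N (X F x k)) (F, \<lambda>m. X F x k m \<and> N (X F x k) < m, X F x (Suc k), c F x k)" for k
        using st(4)[OF goodX[OF that, of F k], of F "fst (st F (X F x k))" "snd (st F (X F x k))"]
        unfolding tail_eq XS c_def by simp
      then show ?thesis
        unfolding diagonal_step_def by (auto simp: X0 i_def y_def least)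
    qed
    ultimately show "\<exists>X c. diagonal_step R' (F, x, z, b) X c" by auto
  qed
  ultimately have "selector B s (\<lambda>F x. (y F x, i F x)) (\<lambda>w. \<exists>X c. diagonal_step R' w X c)"
    unfolding selector_def using sigma11_diagonal_step[OF R'] by simp
  then show ?thesis by blast
qed

text \<open>Induction on \<open>bar\<close> is the recursion on the rank of the front.\<close>

lemma ex_selector:
  assumes "front_on B UNIV" "bar B s"
  shows "\<exists>\<phi> R. selector B s \<phi> R"
  using assms(2)
proof induction
  case (bar_leaf s)
  then show ?case by (rule selector_leaf[OF assms(1)])
next
  case (bar_step s)
  then show ?case by (blast intro: selector_step)
qed

section \<open>An almost disjoint family indexed by colourings\<close>

text \<open>The successor keeps 0 out of the branches, so that they can be extended from the empty stem.\<close>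

definition branch :: "(nat \<Rightarrow> bool) \<Rightarrow> nat \<Rightarrow> bool" where
  "branch F m \<longleftrightarrow> (\<exists>n. m = Suc (to_nat (map F [0..<n])))"

lemma good_branch: "good {} (branch F)"
proof -
  have "inj (\<lambda>n. Suc (to_nat (map F [0..<n])))"
  proof (rule injI)
    fix n n' assume "Suc (to_nat (map F [0..<n])) = Suc (to_nat (map F [0..<n']))"
    then have "map F [0..<n] = map F [0..<n']" by simp
    from arg_cong[OF this, of length] show "n = n'" by simp
  qed
  then have "infinite (range (\<lambda>n. Suc (to_nat (map F [0..<n]))))"
    using finite_imageD by blast
  moreover have "range (\<lambda>n. Suc (to_nat (map F [0..<n]))) = {m. branch F m}"
    unfolding branch_def by auto
  ultimately show ?thesis unfolding good_def branch_def by auto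
qed

text \<open>A common element codes a common restriction, whose length cannot exceed a point where
  \<open>F\<close> and \<open>G\<close> differ.\<close>

lemma finite_branch_Int:
  assumes "F \<noteq> G"
  shows "finite {m. branch F m \<and> branch G m}"
proof -
  obtain k where k: "F k \<noteq> G k" using assms by blast
  have "{m. branch F m \<and> branch G m} \<subseteq> (\<lambda>n. Suc (to_nat (map F [0..<n]))) ` {..k}"
  proof
    fix m assume "m \<in> {m. branch F m \<and> branch G m}"
    then obtain n n' where n: "m = Suc (to_nat (map F [0..<n]))" "map F [0..<n] = map G [0..<n']"
      unfolding branch_def by auto
    have "n' = n" using arg_cong[OF n(2), of length] by simp
    then have "\<forall>j<n. F j = G j" using n(2) by (auto simp: map_eq_conv)
    then have "n \<le> k" using k by (metis not_less)
    then show "m \<in> (\<lambda>n. Suc (to_nat (map F [0..<n]))) ` {..k}" using n(1) by blast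
  qed
  then show ?thesis by (rule finite_subset) simp
qed

text \<open>Whether \<open>m\<close> belongs to the branch depends only on comparing
  \<open>F\<close> with the finite list coded by \<open>m\<close>, if there is one.\<close>

lemma continuous_on_branch: "continuous_on UNIV branch"
proof (rule continuous_on_coordinatewise_then_product)
  fix m
  show "continuous_on UNIV (\<lambda>F. branch F m)"
  proof (cases "\<exists>l :: bool list. m = Suc (to_nat l)")
    case True
    then obtain l :: "bool list" where l: "m = Suc (to_nat l)" by blast
    have "branch F m \<longleftrightarrow> (\<forall>k<length l. F k = l ! k)" for F
    proof
      assume "branch F m"
      then obtain n where "l = map F [0..<n]" unfolding branch_def l by auto
      then show "\<forall>k<length l. F k = l ! k" by simp
    next
      assume "\<forall>k<length l. F k = l ! k"
      then have "l = map F [0..<length l]" by (intro nth_equalityI) auto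
      then show "branch F m" unfolding branch_def l by metis
    qed
    moreover have "continuous_on UNIV (\<lambda>F. \<forall>k<length l. F k = l ! k)"
      by (intro continuous_on_bounded_all continuous_on_iff_pred) simp_all
    ultimately show ?thesis by simp
  next
    case False
    then have "branch F m = False" for F unfolding branch_def by blast
    then show ?thesis by simp
  qed
qed

text \<open>Failure of every constant \<open>c\<close> at some \<open>m\<close> is a countable
  combination of clopen comparisons of finite counts.\<close>

lemma sigma11_not_thin:
  fixes f g :: "'a::topological_space \<Rightarrow> nat \<Rightarrow> bool"
  assumes "continuous_on UNIV f" "continuous_on UNIV g"
  shows "sigma11 (\<lambda>w. \<not> thin {k. f w k} {k. g w k})"
proof -
  have fg: "continuous_on UNIV (\<lambda>w k. f w k \<and> g w k)"
    by (intro continuous_on_coordinatewise_then_product continuous_on_conj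
        continuous_on_product_then_coordinatewise[OF assms(1)]
        continuous_on_product_then_coordinatewise[OF assms(2)])
  have "sigma11 (\<lambda>w. \<forall>c. \<exists>m. c * card {k. k < m \<and> f w k} < (card {k. k < m \<and> f w k \<and> g w k})\<^sup>2)"
    by (intro sigma11_all sigma11_ex sigma11_clopen
        continuous_on_discrete_binary[where k = "\<lambda>a b. _ * a < b\<^sup>2"]
        continuous_on_card_below assms(1) fg)
  moreover have "{k. g w k} \<inter> {k. f w k} \<inter> {..<m} = {k. k < m \<and> f w k \<and> g w k}"
    and "{k. f w k} \<inter> {..<m} = {k. k < m \<and> f w k}" for w m by auto
  ultimately show ?thesis unfolding thin_def by (simp add: not_le)
qed

subsection \<open>The ideal\<close>

theorem mainTheorem5:
  fixes B :: "nat set set"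
  assumes "front_on B UNIV"
  shows "\<exists>I. ideal_on_nat I \<and> tall I \<and> coanalytic I \<and>
           (\<forall>F. F \<subseteq> B \<longrightarrow> \<not> hom B F \<subseteq> I)"
proof -
  obtain \<phi> R where "selector B {} \<phi> R"
    using ex_selector[OF assms front_bar[OF assms]] by blast
  then have R: "sigma11 R"
    and sel: "\<And>F. good {} (fst (\<phi> F (branch F)))" "\<And>F. fst (\<phi> F (branch F)) \<le> branch F"
      "\<And>F. homog_above B F {} (fst (\<phi> F (branch F))) (snd (\<phi> F (branch F)))"
      "\<And>F y i. R (F, branch F, y, i) \<longleftrightarrow> \<phi> F (branch F) = (y, i)"
    unfolding selector_def using good_branch by blast+
  \<comment> \<open>The reservoir is \<open>branch F\<close>, computed from the colouring itself, so
    different colourings get almost disjoint homogeneous sets.\<close>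
  define Y where "Y F = {m. fst (\<phi> F (branch F)) m}" for F
  define I where "I = {x. \<forall>F. thin (Y F) x}"
  have inf: "infinite (Y F)" for F using sel(1) unfolding good_def Y_def by blast
  have ad: "finite (Y F \<inter> Y G)" if "F \<noteq> G" for F G
  proof (rule finite_subset[OF _ finite_branch_Int[OF that]])
    show "Y F \<inter> Y G \<subseteq> {m. branch F m \<and> branch G m}"
      using sel(2) unfolding Y_def by (auto simp: le_fun_def)
  qed
  have "ideal_on_nat I"
    unfolding ideal_on_nat_def I_def by (simp add: thin_finite thin_Un) (metis thin_mono)
  moreover have "tall I"
    unfolding tall_def
  proof (intro allI impI)
    fix x :: "nat set" assume x: "infinite x"
    show "\<exists>z \<subseteq> x. infinite z \<and> z \<in> I"
    proof (cases "\<forall>F. finite (x \<inter> Y F)")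
      case True
      then show ?thesis using x thin_finite unfolding I_def by blast
    next
      case False
      then obtain F where "infinite (x \<inter> Y F)" by blast
      from ex_infinite_thin_subset[OF this, of "Y F"]
      obtain z where z: "z \<subseteq> x \<inter> Y F" "infinite z" "thin (Y F) z" by auto
      have "thin (Y G) z" for G
      proof (cases "G = F")
        case False
        \<comment> \<open>As \<open>z\<close> lies inside \<open>Y F\<close>, almost disjointness
          leaves it a finite trace on every other \<open>Y G\<close>.\<close>
        have "z \<inter> Y G \<subseteq> Y F \<inter> Y G" using z(1) by blast
        then show ?thesis using ad[of F G] False by (metis thin_finite finite_subset)
      qed (simp add: z(3))
      then show ?thesis using z unfolding I_def by blast
    qed
  qed
  moreover have "coanalytic I"
  proof -
    \<comment> \<open>Non-membership in \<open>I\<close> is witnessed by a colouring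
      \<open>F\<close> and a set \<open>y\<close> on which \<open>x\<close> is not thin;
      \<open>R\<close> certifies, with one of the two colours, that \<open>y\<close> is
      \<open>Y F\<close>.\<close>
    have "sigma11 (\<lambda>x. \<exists>F y. (R (F, branch F, y, True) \<or> R (F, branch F, y, False))
        \<and> \<not> thin {k. y k} {k. x k})"
    proof (rule sigma11_ex_set, rule sigma11_ex_set)
      have "continuous_on UNIV (\<lambda>w::((nat \<Rightarrow> bool) \<times> (nat \<Rightarrow> bool)) \<times> (nat \<Rightarrow> bool).
          (snd (fst w), branch (snd (fst w)), snd w, i))" for i :: bool
        by (intro continuous_on_Pair continuous_on_compose2[OF continuous_on_branch]
            continuous_intros) simp_all
      note sigma11_subst[OF R this]
      then show "sigma11 (\<lambda>w::((nat \<Rightarrow> bool) \<times> (nat \<Rightarrow> bool)) \<times> (nat \<Rightarrow> bool).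
          (R (snd (fst w), branch (snd (fst w)), snd w, True) \<or>
           R (snd (fst w), branch (snd (fst w)), snd w, False))
          \<and> \<not> thin {k. snd w k} {k. fst (fst w) k})"
        by (intro sigma11_conj sigma11_disj sigma11_not_thin continuous_intros)
    qed
    from analytic_if_sigma11[OF this] have "analytic {x. \<exists>F y.
        (R (F, branch F, y, True) \<or> R (F, branch F, y, False)) \<and> \<not> thin {k. y k} {k. k \<in> x}}" .
    moreover have "(\<exists>y. (R (F, branch F, y, True) \<or> R (F, branch F, y, False)) \<and>
        \<not> thin {k. y k} {k. k \<in> x}) \<longleftrightarrow> \<not> thin (Y F) x" for F x
      unfolding sel(4) Y_def by (cases "\<phi> F (branch F)"; cases "snd (\<phi> F (branch F))") auto
    ultimately show ?thesis unfolding coanalytic_def I_def by (simp add: Collect_neg_eq[symmetric])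
  qed
  moreover have "\<not> hom B F \<subseteq> I" if "F \<subseteq> B" for F
  proof -
    \<comment> \<open>The family \<open>F\<close> is turned into a colouring of codes; its
      homogeneous set \<open>Y F'\<close> is the required member of \<open>hom B F\<close> outside
      \<open>I\<close>.\<close>
    define F' where "F' n \<longleftrightarrow> set_decode n \<in> F" for n
    have iff: "s \<in> F \<longleftrightarrow> snd (\<phi> F' (branch F'))"
      if "finite s" "s \<subseteq> Y F'" "s \<in> B" for s
    proof -
      have "F' (set_encode ({} \<union> s)) = snd (\<phi> F' (branch F'))"
        by (rule sel(3)[unfolded homog_above_def, rule_format]) (use that Y_def in simp_all)
      then show ?thesis using that(1) by (simp add: F'_def set_encode_inverse)
    qed
    have "Y F' \<in> hom B F"
    proof (cases "snd (\<phi> F' (branch F'))")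
      case True
      then have "{s. finite s \<and> s \<subseteq> Y F'} \<inter> B \<subseteq> F" using iff by blast
      then show ?thesis using inf unfolding hom_def by simp
    next
      case False
      then have "{s. finite s \<and> s \<subseteq> Y F'} \<inter> F = {}" using iff \<open>F \<subseteq> B\<close> by blast
      then show ?thesis using inf unfolding hom_def by simp
    qed
    moreover have "Y F' \<notin> I" using not_thin_self[OF inf] unfolding I_def by blast
    ultimately show ?thesis by blast
  qed
  ultimately show ?thesis by blast
qed

end
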